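(* Let $\epsilon\in(0,1/3)$ and $k=2$. Suppose that an algorithm, over a row arrival stream of points $a^1,\dots,a^n\in\mathbb{R}^d$, maintains an $(\epsilon/15)$-approximate center cost query data structure for $k$-means clustering that outputs a partition. Then the algorithm must use at least $\Omega(n/\epsilon^2)$ bits of space, over any constant number of passes.
   Context: Row arrival stream: the input vectors $a^1,\dots,a^n$ arrive one at a time. For centers $c^1,\dots,c^k$, $\operatorname{cost}(c^1,\dots,c^k)=\sum_{i=1}^n\min_{j\in[k]}\|a^i-c^j\|_2^2$. A $\beta$-approximate center cost query data structure that outputs a partition is one which, for any query centers $c^1,\dots,c^k\in\mathbb{R}^d$, outputs a partition $C^1,\dots,C^k$ of $[n]$ with $\sum_{j=1}^k\sum_{i\in C^j}\|a^i-c^j\|_2^2\le(1+\beta)\operatorname{cost}(c^1,\dots,c^k)$.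
   Formalization: The bound is proved for every dimension d ≥ 1/ε² and for point coordinates from any set containing -1 and 1; for small d it fails, e.g. for d = 1 with coordinates of bounded precision, storing all n points takes O(n) bits. *)

theory Defs
  imports "HOL-Probability.Probability" "Jordan_Normal_Form.Matrix"
begin

definition sqdist :: "real vec \<Rightarrow> real vec \<Rightarrow> real" where
  "sqdist x y = scalar_prod (x - y) (x - y)"

text \<open>Points are indexed by \<open>{..<n}\<close> and centers by \<open>{..<k}\<close>; both live in \<open>carrier_vec d\<close>.\<close>

definition kmeans_cost :: "nat \<Rightarrow> nat \<Rightarrow> (nat \<Rightarrow> real vec) \<Rightarrow> (nat \<Rightarrow> real vec) \<Rightarrow> real" where
  "kmeans_cost n k a c = (\<Sum>i<n. Min ((\<lambda>j. sqdist (a i) (c j)) ` {..<k}))"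

text \<open>Parts may be empty: some of the query centers may attract no point.\<close>

definition is_partition :: "nat \<Rightarrow> nat \<Rightarrow> (nat \<Rightarrow> nat set) \<Rightarrow> bool" where
  "is_partition n k C \<longleftrightarrow> disjoint_family_on C {..<k} \<and> (\<Union>j<k. C j) = {..<n}"

definition approx_partition ::
    "real \<Rightarrow> nat \<Rightarrow> nat \<Rightarrow> (nat \<Rightarrow> real vec) \<Rightarrow> (nat \<Rightarrow> real vec) \<Rightarrow> (nat \<Rightarrow> nat set) \<Rightarrow> bool" where
  "approx_partition \<beta> n k a c C \<longleftrightarrow> is_partition n k C \<and>
     (\<Sum>j<k. \<Sum>i\<in>C j. sqdist (a i) (c j)) \<le> (1 + \<beta>) * kmeans_cost n k a c"

text \<open>A randomized streaming algorithm whose memory contents are bit strings. The first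
  argument of each operation is a random tape drawn from \<open>tape\<close>; tape access is not charged as
  space, and a deterministic algorithm is one that ignores its tape. The \<open>nat\<close> argument of
  \<open>step\<close> is the number of updates made so far, so the position in the stream and the number of
  the current pass are not charged either. Nothing is assumed about computability, and an
  algorithm may depend on all parameters; each of these liberties only enlarges the class of
  algorithms to which a lower bound applies.\<close>

record stream_alg =
  tape :: "(nat \<Rightarrow> bool) measure"
  init :: "(nat \<Rightarrow> bool) \<Rightarrow> bool list"
  step :: "(nat \<Rightarrow> bool) \<Rightarrow> nat \<Rightarrow> bool list \<Rightarrow> real vec \<Rightarrow> bool list"
  answer :: "(nat \<Rightarrow> bool) \<Rightarrow> bool list \<Rightarrow> (nat \<Rightarrow> real vec) \<Rightarrow> nat \<Rightarrow> nat set"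

text \<open>Memory contents after \<open>t\<close> updates, when the stream \<open>a 0, \<dots>, a (n - 1)\<close> is read
  repeatedly in order; pass number \<open>p\<close> is complete after \<open>p * n\<close> updates.\<close>

primrec memory ::
    "stream_alg \<Rightarrow> nat \<Rightarrow> (nat \<Rightarrow> real vec) \<Rightarrow> (nat \<Rightarrow> bool) \<Rightarrow> nat \<Rightarrow> bool list" where
  "memory A n a \<omega> 0 = init A \<omega>"
| "memory A n a \<omega> (Suc t) = step A \<omega> t (memory A n a \<omega> t) (a (t mod n))"

text \<open>The streams of \<open>n\<close> points of \<open>\<real>\<^sup>d\<close> with coordinates in \<open>S\<close>. The set \<open>S\<close> makes
  bit complexity meaningful: for \<open>S = UNIV\<close> already \<open>n = d = 1\<close> cannot be handled in finite
  space, while bounded-precision numbers form a finite \<open>S\<close>.\<close>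

definition streams_over :: "real set \<Rightarrow> nat \<Rightarrow> nat \<Rightarrow> (nat \<Rightarrow> real vec) set" where
  "streams_over S n d = {a. \<forall>i<n. a i \<in> carrier_vec d \<and> (\<forall>l<d. vec_index (a i) l \<in> S)}"

text \<open>Queries come after the last pass, are answered from the memory contents alone, and have
  arbitrary real centers. Each fixed query has to succeed with probability at least \<open>2/3\<close>,
  which is weaker than success on all queries simultaneously.\<close>

definition maintains_center_cost_partition ::
    "stream_alg \<Rightarrow> nat \<Rightarrow> real set \<Rightarrow> real \<Rightarrow> nat \<Rightarrow> nat \<Rightarrow> nat \<Rightarrow> bool" where
  "maintains_center_cost_partition A passes S \<beta> n d k \<longleftrightarrow> prob_space (tape A) \<and>
     (\<forall>a \<in> streams_over S n d. \<forall>c. (\<forall>j<k. c j \<in> carrier_vec d) \<longrightarrow>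
        measure (tape A) {\<omega> \<in> space (tape A).
          approx_partition \<beta> n k a c (answer A \<omega> (memory A n a \<omega> (passes * n)) c)} \<ge> 2/3)"

definition uses_space_at_most ::
    "stream_alg \<Rightarrow> nat \<Rightarrow> real set \<Rightarrow> nat \<Rightarrow> nat \<Rightarrow> nat \<Rightarrow> bool" where
  "uses_space_at_most A passes S n d s \<longleftrightarrow>
     (\<forall>a \<in> streams_over S n d. \<forall>\<omega> \<in> space (tape A). \<forall>t \<le> passes * n.
        length (memory A n a \<omega> t) \<le> s)"

end

theory Submission
  imports Defs
begin

text \<open>
  Take $m = \lfloor 1/\epsilon^2 \rfloor$ and encode an arbitrary $n \times m$ bit matrix in the
  signs of the first $m$ coordinates of the points. With the two centers
  $\pm \epsilon^{-1} e_j$, a point put on the wrong side costs an extra $4/\epsilon$, whereas the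
  permitted excess is at most $(\epsilon/15) \cdot 2n/\epsilon^2$; so a correct answer reveals
  column $j$ of the matrix up to $n/30$ errors. The answers depend only on the final memory, so
  the number of passes plays no role. Averaging over the tape fixes a deterministic encoding of
  all matrices into $s$ bits from which a fraction $\frac23\cdot\frac{29}{30} = \frac{29}{45}$ of
  all bits is recovered on average, and since $29/45 > 1/2$ an exponential moment bound gives
  $nm \le 45 s$.
\<close>

section \<open>Counting short bit strings and recovered bits\<close>

lemma card_bool_lists_length_le:
  "finite {l :: bool list. length l \<le> s}" "card {l :: bool list. length l \<le> s} \<le> 4 ^ s"
proof -
  \<comment> \<open>The count \<open>2 ^ (s + 1) - 1\<close> is relaxed to a pure power of
    \<open>4\<close>, still correct at \<open>s = 0\<close>, so that no additive constant enters the
    space bound.\<close>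
  have "(\<Sum>i\<le>s. 2 ^ i) \<le> (4 :: nat) ^ s"
  proof (induction s)
    case (Suc s)
    have "(2::nat) ^ s \<le> 4 ^ s"
      by (intro power_mono) auto
    with Suc show ?case by simp
  qed simp
  then show "card {l :: bool list. length l \<le> s} \<le> 4 ^ s"
    using card_lists_length_le[of "UNIV :: bool set" s] by simp
  show "finite {l :: bool list. length l \<le> s}"
    using finite_lists_length_le[of "UNIV :: bool set" s] by simp
qed

text \<open>Each element of \<open>I\<close> contributes a factor \<open>2\<close> if
  \<open>T\<close> and \<open>D\<close> agree there and \<open>1\<close> otherwise. The sum over all
  \<open>T\<close> is therefore an expanded product whose factors are \<open>2 + 1\<close>, whatever
  \<open>D\<close> is.\<close>

lemma sum_power2_agreement:
  assumes "finite I"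
  shows "(\<Sum>T\<in>Pow I. (2::real) ^ card {x \<in> I. x \<in> T \<longleftrightarrow> x \<in> D}) = 3 ^ card I"
proof -
  let ?f = "\<lambda>x. if x \<in> D then (2::real) else 1"
  let ?g = "\<lambda>x. if x \<in> D then (1::real) else 2"
  have "(2::real) ^ card {x \<in> I. x \<in> T \<longleftrightarrow> x \<in> D} = prod ?f T * prod ?g (I - T)"
    if "T \<in> Pow I" for T
  proof -
    have fin: "finite T" using that assms finite_subset by auto
    have "{x \<in> I. x \<in> T \<longleftrightarrow> x \<in> D} = (T \<inter> D) \<union> ((I - T) \<inter> - D)"
      using that by auto
    then have "card {x \<in> I. x \<in> T \<longleftrightarrow> x \<in> D} = card (T \<inter> D) + card ((I - T) \<inter> - D)"
      using fin assms by (simp add: card_Un_disjoint disjoint_iff)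
    moreover have "prod ?f T = 2 ^ card (T \<inter> D)"
      using fin by (simp add: prod.If_cases)
    moreover have "prod ?g (I - T) = 2 ^ card ((I - T) \<inter> - D)"
      using assms by (simp add: prod.If_cases Compl_eq)
    ultimately show ?thesis by (simp add: power_add)
  qed
  then have "(\<Sum>T\<in>Pow I. (2::real) ^ card {x \<in> I. x \<in> T \<longleftrightarrow> x \<in> D}) = (\<Prod>x\<in>I. ?f x + ?g x)"
    using prod_add[OF assms, of ?f ?g] by simp
  also have "\<dots> = (\<Prod>x\<in>I. 3)"
    by (intro prod.cong) auto
  finally show ?thesis by simp
qed

text \<open>Jensen's inequality for \<open>exp\<close>, obtained by summing the tangent-line bound
  at \<open>\<mu>\<close>.\<close>

lemma sum_exp_ge_of_mean:
  fixes f :: "'a \<Rightarrow> real" and \<mu> :: real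
  assumes "(\<Sum>x\<in>X. f x) \<ge> \<mu> * card X"
  shows "(\<Sum>x\<in>X. exp (f x)) \<ge> card X * exp \<mu>"
proof -
  have "card X \<le> (\<Sum>x\<in>X. 1 + (f x - \<mu>))"
    using assms by (simp add: sum.distrib sum_subtractf mult.commute)
  also have "\<dots> \<le> (\<Sum>x\<in>X. exp (f x - \<mu>))"
    by (intro sum_mono exp_ge_add_one_self)
  also have "\<dots> = (\<Sum>x\<in>X. exp (f x)) / exp \<mu>"
    by (simp add: exp_diff sum_divide_distrib)
  finally show ?thesis by (simp add: field_simps)
qed

text \<open>Two bounds on the sum of \<open>2 ^ ag T (dec (enc T))\<close> over all \<open>T\<close>
  are compared, with \<open>N = card I\<close>: Jensen gives at least
  \<open>2 ^ N * 2 powr (29 / 45 * N)\<close>, and a sum over all possible code words gives at most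
  \<open>4 ^ s * 3 ^ N\<close>.\<close>

lemma card_le_of_recovered_bits:
  fixes enc :: "'a set \<Rightarrow> bool list" and dec :: "bool list \<Rightarrow> 'a set"
  assumes fin: "finite I"
    and len: "\<And>T. T \<subseteq> I \<Longrightarrow> length (enc T) \<le> s"
    and agree: "(\<Sum>T\<in>Pow I. real (card {x \<in> I. x \<in> T \<longleftrightarrow> x \<in> dec (enc T)}))
                  \<ge> 29 / 45 * real (card I) * 2 ^ card I"
  shows "card I \<le> 45 * s"
proof -
  define N where "N = card I"
  define L where "L = {l :: bool list. length l \<le> s}"
  define ag where "ag T D = card {x \<in> I. x \<in> T \<longleftrightarrow> x \<in> D}" for T D
  have L: "finite L" "real (card L) \<le> 4 ^ s"
    using card_bool_lists_length_le[of s] of_nat_mono[of "card L" "4 ^ s", where 'a = real]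
    by (simp_all add: L_def)
  have "(ln 2 * (29 / 45 * N)) * card (Pow I) \<le> ln 2 * (\<Sum>T\<in>Pow I. real (ag T (dec (enc T))))"
    using mult_left_mono[OF agree, of "ln 2"] fin
    by (simp add: card_Pow ag_def N_def mult.assoc)
  then have "card (Pow I) * exp (ln 2 * (29 / 45 * N)) \<le> (\<Sum>T\<in>Pow I. exp (ln 2 * real (ag T (dec (enc T)))))"
    by (intro sum_exp_ge_of_mean) (simp add: sum_distrib_left)
  also have "\<dots> = (\<Sum>T\<in>Pow I. 2 ^ ag T (dec (enc T)))"
    by (simp flip: powr_realpow add: powr_def mult.commute)
  also have "\<dots> \<le> (\<Sum>T\<in>Pow I. \<Sum>l\<in>L. 2 ^ ag T (dec l))"
  proof (intro sum_mono)
    fix T assume "T \<in> Pow I"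
    then have "enc T \<in> L" using len by (simp add: L_def)
    then show "(2::real) ^ ag T (dec (enc T)) \<le> (\<Sum>l\<in>L. 2 ^ ag T (dec l))"
      using L(1) by (intro member_le_sum[of "enc T" L "\<lambda>l. (2::real) ^ ag T (dec l)"]) auto
  qed
  also have "\<dots> = real (card L) * 3 ^ N"
    unfolding ag_def N_def by (subst sum.swap) (simp add: sum_power2_agreement[OF fin])
  also have "\<dots> \<le> 4 ^ s * 3 ^ N"
    using L(2) by (intro mult_right_mono) auto
  finally have "2 ^ N * exp (ln 2 * (29 / 45 * N)) \<le> 4 ^ s * 3 ^ N"
    using fin by (simp add: card_Pow N_def)
  \<comment> \<open>The power \<open>45\<close> clears the denominator of the exponent
    \<open>29 / 45\<close>.\<close>
  then have "(2 ^ N * exp (ln 2 * (29 / 45 * N))) ^ 45 \<le> (4 ^ s * 3 ^ N :: real) ^ 45"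
    by (intro power_mono) auto
  moreover have "exp (ln 2 * (29 / 45 * N)) ^ 45 = ((2::real) ^ 29) ^ N"
  proof -
    have "exp (ln 2 * (29 / 45 * N)) ^ 45 = exp (real (29 * N) * ln 2)"
      by (simp flip: exp_of_nat_mult)
    also have "\<dots> = 2 ^ (29 * N)"
      by (subst exp_of_nat_mult) simp
    finally show ?thesis by (simp only: power_mult)
  qed
  ultimately have "(2 ^ 45 * 2 ^ 29) ^ N \<le> (4 ^ 45) ^ s * ((3::real) ^ 45) ^ N"
    by (simp only: power_mult_distrib flip: power_mult) (simp only: mult.commute)
  \<comment> \<open>Numerically \<open>4 * 3 ^ 45 \<le> 2 ^ 74\<close>; the spare factor
    \<open>4\<close> matches the base of \<open>4 ^ (45 * s)\<close>.\<close>
  moreover have "(4 * 3 ^ 45) ^ N \<le> ((2::real) ^ 45 * 2 ^ 29) ^ N"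
    by (intro power_mono) auto
  ultimately have "4 ^ N * ((3::real) ^ 45) ^ N \<le> (4 ^ 45) ^ s * (3 ^ 45) ^ N"
    by (simp only: power_mult_distrib)
  then have "(4::real) ^ N \<le> 4 ^ (45 * s)"
    by (simp add: power_mult)
  then show ?thesis by (simp add: N_def)
qed

section \<open>Fixing the random tape by a first-moment argument\<close>

text \<open>The hypothesis \<open>p > 0\<close> also yields measurability of the events, because
  \<^const>\<open>measure\<close> is zero on non-measurable sets.\<close>

lemma (in prob_space) exists_outcome_many_events:
  assumes "finite X" and "p > 0"
    and "\<And>x. x \<in> X \<Longrightarrow> measure M {\<omega> \<in> space M. P x \<omega>} \<ge> p"
  obtains \<omega> where "\<omega> \<in> space M" "real (card {x \<in> X. P x \<omega>}) \<ge> p * card X"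
proof -
  let ?E = "\<lambda>x. {\<omega> \<in> space M. P x \<omega>}"
  have meas: "?E x \<in> sets M" if "x \<in> X" for x
    using assms(2) assms(3)[OF that] measure_notin_sets[of "?E x" M] by fastforce
  have int: "integrable M (\<lambda>\<omega>. \<Sum>x\<in>X. indicator (?E x) \<omega> :: real)"
    using meas by (intro Bochner_Integration.integrable_sum integrable_real_indicator)
      (auto simp: emeasure_eq_measure)
  have "p * card X \<le> (\<Sum>x\<in>X. measure M (?E x))"
    using sum_mono[of X "\<lambda>_. p", OF assms(3)] by (simp add: mult.commute)
  also have "\<dots> = expectation (\<lambda>\<omega>. \<Sum>x\<in>X. indicator (?E x) \<omega> :: real)"
    using meas by (subst Bochner_Integration.integral_sum)
      (auto simp: emeasure_eq_measure intro!: sum.cong integrable_real_indicator)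
  finally have mean: "p * card X \<le> expectation (\<lambda>\<omega>. \<Sum>x\<in>X. indicator (?E x) \<omega> :: real)" .
  have "\<exists>\<omega>\<in>space M. p * card X \<le> (\<Sum>x\<in>X. indicator (?E x) \<omega> :: real)"
  proof (rule ccontr)
    assume "\<not> ?thesis"
    then have "expectation (\<lambda>\<omega>. \<Sum>x\<in>X. indicator (?E x) \<omega> :: real) < p * card X"
      by (intro expectation_less[OF int]) (auto simp: not_le)
    with mean show False by simp
  qed
  then obtain \<omega> where \<omega>: "\<omega> \<in> space M" "p * card X \<le> (\<Sum>x\<in>X. indicator (?E x) \<omega> :: real)" ..
  have "(\<Sum>x\<in>X. indicator (?E x) \<omega> :: real) = card {x \<in> X. P x \<omega>}"
    using \<omega>(1) assms(1) by (simp add: indicator_def sum.If_cases Int_def)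
  with \<omega> that show thesis by simp
qed

section \<open>Hard point sets and the queries that read one column\<close>

definition bit_points :: "nat \<Rightarrow> (nat \<times> nat) set \<Rightarrow> nat \<Rightarrow> real vec" where
  "bit_points d T i = Matrix.vec d (\<lambda>l. if (i, l) \<in> T then 1 else - 1)"

text \<open>Beyond the first \<open>m\<close> coordinates the centers agree with the points encoding subsets
  of \<open>{..<n} \<times> {..<m}\<close>, so that these coordinates contribute nothing to the cost.\<close>

definition column_query :: "nat \<Rightarrow> nat \<Rightarrow> real \<Rightarrow> nat \<Rightarrow> nat \<Rightarrow> real vec" where
  "column_query d m r j k = Matrix.vec d
     (\<lambda>l. if l = j then (if k = 0 then r else - r) else if l < m then 0 else - 1)"

lemma bit_points_in_streams_over:
  "{-1, 1} \<subseteq> S \<Longrightarrow> bit_points d T \<in> streams_over S n d"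
  by (auto simp: streams_over_def bit_points_def)

text \<open>Coordinates below \<open>m\<close> other than \<open>j\<close> contribute
  \<open>1\<close> each. Coordinate \<open>j\<close> contributes \<open>(r - 1)\<^sup>2\<close> or
  \<open>(r + 1)\<^sup>2\<close>, which differ by \<open>4 * r\<close>.\<close>

lemma sqdist_bit_points_column_query:
  assumes "T \<subseteq> {..<n} \<times> {..<m}" "m \<le> d" "j < m"
  shows "sqdist (bit_points d T i) (column_query d m r j k) =
           real m - 1 + (r - 1)\<^sup>2 + (if ((i, j) \<in> T) = (k = 0) then 0 else 4 * r)"
proof -
  let ?h = "\<lambda>l. ((if (i, l) \<in> T then 1 else - 1) -
      (if l = j then (if k = 0 then r else - r) else if l < m then 0 else - 1) :: real)"
  have "sqdist (bit_points d T i) (column_query d m r j k) = (\<Sum>l<d. (?h l)\<^sup>2)"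
    by (simp add: sqdist_def bit_points_def column_query_def scalar_prod_def power2_eq_square
        atLeast0LessThan)
  \<comment> \<open>From \<open>m\<close> on, point and center are both \<open>- 1\<close>, because
    \<open>T\<close> contains no pair with such a second component.\<close>
  also have "\<dots> = (\<Sum>l<m. (?h l)\<^sup>2)"
    using assms by (intro sum.mono_neutral_right) auto
  also have "\<dots> = (?h j)\<^sup>2 + (\<Sum>l\<in>{..<m} - {j}. (?h l)\<^sup>2)"
    using assms by (intro sum.remove) auto
  also have "(\<Sum>l\<in>{..<m} - {j}. (?h l)\<^sup>2) = (\<Sum>l\<in>{..<m} - {j}. 1)"
    by (intro sum.cong) auto
  also have "\<dots> = real m - 1"
    using assms by (simp add: of_nat_diff)
  finally show ?thesis
    by (auto simp: power2_eq_square algebra_simps)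
qed

lemma approx_partition_reads_column:
  assumes T: "T \<subseteq> {..<n} \<times> {..<m}" and md: "m \<le> d" and j: "j < m"
    and eps: "0 < \<epsilon>" "\<epsilon> < 1" and m: "real m \<le> 1 / \<epsilon>\<^sup>2"
    and C: "approx_partition (\<epsilon> / 15) n 2 (bit_points d T) (column_query d m (1 / \<epsilon>) j) C"
  shows "real (card {i. i < n \<and> ((i, j) \<in> T \<longleftrightarrow> i \<in> C 0)}) \<ge> 29 / 30 * real n"
proof -
  define r where "r = 1 / \<epsilon>"
  \<comment> \<open>\<open>b\<close> is the squared distance from any point to the center on its own
    side; \<open>W\<close> collects the misplaced points.\<close>
  define b where "b = real m - 1 + (r - 1)\<^sup>2"
  define W where "W = {i. i < n \<and> \<not> ((i, j) \<in> T \<longleftrightarrow> i \<in> C 0)}"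
  let ?D = "\<lambda>i k. sqdist (bit_points d T i) (column_query d m r j k)"
  have r: "r > 1" using eps by (simp add: r_def)
  have D: "?D i k = b + (if ((i, j) \<in> T) = (k = 0) then 0 else 4 * r)" for i k
    using sqdist_bit_points_column_query[OF T md j] by (simp add: b_def)
  have two: "{..<2::nat} = {0, 1}" by auto
  have part: "C 0 \<inter> C 1 = {}" "C 0 \<union> C 1 = {..<n}"
    using C by (auto simp: approx_partition_def is_partition_def disjoint_family_on_def two)
  have cost: "kmeans_cost n 2 (bit_points d T) (column_query d m r j) = real n * b"
  proof -
    have "min (?D i 0) (?D i 1) = b" for i
      using r by (simp add: D)
    then show ?thesis by (simp add: kmeans_cost_def two)
  qed
  have finC: "finite (C 0)" "finite (C 1)"
    using part(2) finite_Un[of "C 0" "C 1"] by auto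
  have "(\<Sum>k<2. \<Sum>i\<in>C k. ?D i k) = (\<Sum>i\<in>C 0. ?D i 0) + (\<Sum>i\<in>C 1. ?D i 1)"
    by (simp add: two)
  also have "\<dots> = (\<Sum>i\<in>C 0. b + (if i \<in> W then 4 * r else 0)) + (\<Sum>i\<in>C 1. b + (if i \<in> W then 4 * r else 0))"
    using part by (intro arg_cong2[where f = "(+)"] sum.cong) (auto simp: D W_def)
  also have "\<dots> = (\<Sum>i<n. b + (if i \<in> W then 4 * r else 0))"
    using part finC by (simp flip: part(2) add: sum.union_disjoint)
  also have "\<dots> = real n * b + 4 * r * card W"
    by (simp add: sum.distrib sum.If_cases W_def Int_def)
  finally have "real n * b + 4 * r * card W \<le> (1 + \<epsilon> / 15) * (real n * b)"
    using C cost by (simp add: approx_partition_def r_def)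
  then have "4 * r * card W \<le> \<epsilon> / 15 * (real n * b)"
    by (simp add: algebra_simps)
  \<comment> \<open>Both parts of \<open>b\<close> are at most \<open>r\<^sup>2\<close>: the
    \<open>m - 1\<close> unit terms because \<open>m \<le> r\<^sup>2\<close>, and
    \<open>(r - 1)\<^sup>2\<close> because \<open>r > 1\<close>.\<close>
  also have "\<dots> \<le> \<epsilon> / 15 * (real n * (2 * r\<^sup>2))"
  proof -
    have "real m \<le> r\<^sup>2" using m by (simp add: r_def power_one_over)
    then have "b \<le> 2 * r\<^sup>2"
      using r by (simp add: b_def power2_eq_square algebra_simps)
    then show ?thesis using eps by (intro mult_left_mono) auto
  qed
  also have "\<dots> = 2 / 15 * r * real n"
    using eps by (simp add: r_def power2_eq_square)
  finally have "r * (4 * card W) \<le> r * (2 / 15 * real n)"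
    by (simp add: algebra_simps)
  then have "real (card W) \<le> real n / 30"
    using r by (simp add: mult_le_cancel_left)
  moreover have "card {i. i < n \<and> ((i, j) \<in> T \<longleftrightarrow> i \<in> C 0)} + card W = card {..<n}"
    unfolding W_def
    by (subst card_Un_disjoint[symmetric]) (auto intro!: arg_cong[where f = card] simp flip: card_lessThan)
  ultimately show ?thesis by simp
qed

section \<open>From the streaming algorithm to the space bound\<close>

lemma stream_bits_le_space:
  assumes eps: "0 < \<epsilon>" "\<epsilon> < 1" and m: "m \<le> d" "real m \<le> 1 / \<epsilon>\<^sup>2" and S: "{-1, 1} \<subseteq> S"
    and A: "maintains_center_cost_partition A passes S (\<epsilon> / 15) n d 2"
    and space: "uses_space_at_most A passes S n d s"
  shows "n * m \<le> 45 * s"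
proof -
  define I where "I = {..<n} \<times> {..<m}"
  define q where "q = column_query d m (1 / \<epsilon>)"
  define enc where "enc \<omega> T = memory A n (bit_points d T) \<omega> (passes * n)" for \<omega> T
  define good where "good = (\<lambda>(T, j) \<omega>. approx_partition (\<epsilon> / 15) n 2 (bit_points d T) (q j)
      (answer A \<omega> (enc \<omega> T) (q j)))"
  have fin: "finite I" by (simp add: I_def)
  have "q j k \<in> carrier_vec d" for j k
    by (simp add: q_def column_query_def)
  then have succ: "measure (tape A) {\<omega> \<in> Sigma_Algebra.space (tape A). good x \<omega>} \<ge> 2 / 3" for x
    using A bit_points_in_streams_over[OF S]
    by (cases x) (simp add: maintains_center_cost_partition_def good_def enc_def)
  interpret prob_space "tape A"
    using A by (simp add: maintains_center_cost_partition_def)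
  \<comment> \<open>Averaging over all pairs \<open>(T, j)\<close> at once yields a single outcome
    for every matrix and column; with it fixed, \<open>dec\<close> depends on the memory string
    alone.\<close>
  obtain \<omega> where \<omega>: "\<omega> \<in> Sigma_Algebra.space (tape A)"
    and many: "real (card {x \<in> Pow I \<times> {..<m}. good x \<omega>}) \<ge> 2 / 3 * card (Pow I \<times> {..<m})"
    using exists_outcome_many_events[of "Pow I \<times> {..<m}" "2 / 3" good] succ fin by auto
  define dec where "dec l = {(i, j). i \<in> answer A \<omega> l (q j) 0}" for l
  define ag where "ag T j = card {i. i < n \<and> ((i, j) \<in> T \<longleftrightarrow> i \<in> answer A \<omega> (enc \<omega> T) (q j) 0)}" for T j
  have agree: "card {x \<in> I. x \<in> T \<longleftrightarrow> x \<in> dec (enc \<omega> T)} = (\<Sum>j<m. ag T j)" for T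
  proof -
    have "{x \<in> I. x \<in> T \<longleftrightarrow> x \<in> dec (enc \<omega> T)} = prod.swap `
        (SIGMA j:{..<m}. {i. i < n \<and> ((i, j) \<in> T \<longleftrightarrow> i \<in> answer A \<omega> (enc \<omega> T) (q j) 0)})"
      by (auto simp: I_def dec_def image_iff)
    then show ?thesis
      by (simp add: card_image ag_def)
  qed
  \<comment> \<open>A pair on which the answer fails is credited with no recovered bits.\<close>
  have col: "(if good (T, j) \<omega> then 29 / 30 * real n else 0) \<le> real (ag T j)"
    if "T \<in> Pow I" "j < m" for T j
    using approx_partition_reads_column[of T n m d j \<epsilon> "answer A \<omega> (enc \<omega> T) (q j)"] that eps m
    by (auto simp: ag_def good_def q_def I_def)
  have "29 / 45 * real (card I) * 2 ^ card I = 29 / 30 * real n * (2 / 3 * card (Pow I \<times> {..<m}))"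
    using fin by (simp add: card_cartesian_product card_Pow I_def)
  also have "\<dots> \<le> 29 / 30 * real n * card {x \<in> Pow I \<times> {..<m}. good x \<omega>}"
    using many by (intro mult_left_mono) auto
  also have "\<dots> = (\<Sum>x\<in>Pow I \<times> {..<m}. if good x \<omega> then 29 / 30 * real n else 0)"
    using fin by (simp add: sum.If_cases Int_def)
  also have "\<dots> = (\<Sum>T\<in>Pow I. \<Sum>j<m. if good (T, j) \<omega> then 29 / 30 * real n else 0)"
    by (simp add: sum.cartesian_product case_prod_unfold)
  also have "\<dots> \<le> (\<Sum>T\<in>Pow I. \<Sum>j<m. real (ag T j))"
    using col by (intro sum_mono) auto
  also have "\<dots> = (\<Sum>T\<in>Pow I. real (card {x \<in> I. x \<in> T \<longleftrightarrow> x \<in> dec (enc \<omega> T)}))"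
    by (simp add: agree)
  finally have "29 / 45 * real (card I) * 2 ^ card I \<le> \<dots>" .
  moreover have "length (enc \<omega> T) \<le> s" for T
    using space \<omega> bit_points_in_streams_over[OF S] by (simp add: uses_space_at_most_def enc_def)
  ultimately have "card I \<le> 45 * s"
    by (intro card_le_of_recovered_bits[OF fin, of "enc \<omega>" s dec])
  then show ?thesis by (simp add: I_def card_cartesian_product)
qed

theorem mainTheorem14:
  fixes passes :: nat
  assumes "passes \<ge> 1"
  shows "\<exists>c::real. c > 0 \<and>
    (\<forall>(\<epsilon>::real) (n::nat) (d::nat) (S::real set) (A::stream_alg) (s::nat).
       0 < \<epsilon> \<and> \<epsilon> < 1/3 \<and> real d \<ge> 1 / \<epsilon>\<^sup>2 \<and> {-1, 1} \<subseteq> S \<and>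
       maintains_center_cost_partition A passes S (\<epsilon> / 15) n d 2 \<and>
       uses_space_at_most A passes S n d s
       \<longrightarrow> real s \<ge> c * (real n / \<epsilon>\<^sup>2))"
proof (intro exI[of _ "1 / 90"] conjI allI impI)
  fix \<epsilon> :: real and n d :: nat and S :: "real set" and A :: stream_alg and s :: nat
  assume H: "0 < \<epsilon> \<and> \<epsilon> < 1/3 \<and> real d \<ge> 1 / \<epsilon>\<^sup>2 \<and> {-1, 1} \<subseteq> S \<and>
       maintains_center_cost_partition A passes S (\<epsilon> / 15) n d 2 \<and>
       uses_space_at_most A passes S n d s"
  define m where "m = nat \<lfloor>1 / \<epsilon>\<^sup>2\<rfloor>"
  have "\<epsilon>\<^sup>2 \<le> (1 / 3)\<^sup>2"
    using H by (intro power_mono) auto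
  then have large: "1 / \<epsilon>\<^sup>2 \<ge> 9"
    using H by (simp add: field_simps power2_eq_square)
  have m_le: "real m \<le> 1 / \<epsilon>\<^sup>2" and m_ge: "real m \<ge> 1 / \<epsilon>\<^sup>2 - 1"
    using large unfolding m_def by linarith+
  have "m \<le> d"
    using m_le H by linarith
  then have "n * m \<le> 45 * s"
    using stream_bits_le_space[of \<epsilon> m d S A passes n s] H m_le by auto
  then have "real n * real m \<le> 45 * real s"
    by (metis of_nat_le_iff of_nat_mult of_nat_numeral)
  \<comment> \<open>As \<open>1 / \<epsilon>\<^sup>2 \<ge> 9\<close>, rounding down to
    \<open>m\<close> loses less than half, which turns \<open>45\<close> into
    \<open>90\<close>.\<close>
  moreover have "real n * (1 / \<epsilon>\<^sup>2 / 2) \<le> real n * real m"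
    using large m_ge by (intro mult_left_mono) auto
  ultimately show "1 / 90 * (real n / \<epsilon>\<^sup>2) \<le> real s"
    by simp
qed simp

end
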